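(* Let $n=a_1a_2a_3$ with $a_1,a_2,a_3$ positive integers and $b_i=n/a_i$ for $i\in\{1,2,3\}$. Suppose $\mathcal L$ is a family of mutually orthogonal $(n,3,2,1)$ Sudoku hypercubes for a fixed block partition with block size $(b_1,b_2,b_3)$. If $b_1<n$, then $$|\mathcal L|\le b_1(b_2-1)(b_3-1).$$
   Context: Write $[n]=\{1,\dots,n\}$. An $(n,3,2,1)$ Latin hypercube is a function $L:[n]^3\to S$ with $|S|=n^2$ such that every hyperplane (the set of cells obtained by fixing one of the three coordinates) contains each symbol of $S$ exactly once. Block partition of block size $(b_1,b_2,b_3)$: for each $i\in\{1,2,3\}$, the $i$th coordinate set $[n]$ is partitioned into $a_i$ groups of size $b_i$; the blocks are the Cartesian products of three groups, one from each coordinate. An $(n,3,2,1)$ Sudoku hypercube for this block partition is an $(n,3,2,1)$ Latin hypercube in which every block contains each symbol exactly once. Two hypercubes $L:[n]^3\to S$ and $M:[n]^3\to T$ are orthogonal if no ordered pair $(s,t)\in S\times T$ occurs in more than one cell when $L$ and $M$ are superimposed, i.e. $x\mapsto(L(x),M(x))$ is injective on $[n]^3$. A family is mutually orthogonal if any two distinct members are orthogonal. *)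

theory Defs
  imports Main "HOL-Library.FuncSet" "HOL-Library.Disjoint_Sets"
begin

type_synonym cell = "nat \<times> nat \<times> nat"

definition cube :: "nat \<Rightarrow> cell set" where
  "cube n = {1..n} \<times> {1..n} \<times> {1..n}"

definition hyperplanes :: "nat \<Rightarrow> cell set set" where
  "hyperplanes n =
     {{c} \<times> {1..n} \<times> {1..n} | c. c \<in> {1..n}} \<union>
     {{1..n} \<times> {c} \<times> {1..n} | c. c \<in> {1..n}} \<union>
     {{1..n} \<times> {1..n} \<times> {c} | c. c \<in> {1..n}}"

definition each_symbol_once :: "'s set \<Rightarrow> (cell \<Rightarrow> 's) \<Rightarrow> cell set \<Rightarrow> bool" where
  "each_symbol_once S L B \<longleftrightarrow> (\<forall>s\<in>S. \<exists>!x. x \<in> B \<and> L x = s)"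

text \<open>An \<open>(n,3,2,1)\<close> Latin hypercube. The extensional function space makes equality of
  hypercubes coincide with equality of functions on the cube.\<close>

definition latin_hypercube :: "nat \<Rightarrow> 's set \<Rightarrow> (cell \<Rightarrow> 's) \<Rightarrow> bool" where
  "latin_hypercube n S L \<longleftrightarrow>
     L \<in> cube n \<rightarrow>\<^sub>E S \<and> finite S \<and> card S = n ^ 2 \<and>
     (\<forall>H\<in>hyperplanes n. each_symbol_once S L H)"

text \<open>The groups need not consist of consecutive integers.\<close>

definition equal_partition :: "nat \<Rightarrow> nat \<Rightarrow> nat \<Rightarrow> nat set set \<Rightarrow> bool" where
  "equal_partition n a b P \<longleftrightarrow>
     partition_on {1..n} P \<and> card P = a \<and> (\<forall>G\<in>P. card G = b)"

definition blocks :: "nat set set \<Rightarrow> nat set set \<Rightarrow> nat set set \<Rightarrow> cell set set" where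
  "blocks P1 P2 P3 = {G1 \<times> G2 \<times> G3 | G1 G2 G3. G1 \<in> P1 \<and> G2 \<in> P2 \<and> G3 \<in> P3}"

definition sudoku_hypercube ::
  "nat \<Rightarrow> nat set set \<Rightarrow> nat set set \<Rightarrow> nat set set \<Rightarrow> 's set \<Rightarrow> (cell \<Rightarrow> 's) \<Rightarrow> bool" where
  "sudoku_hypercube n P1 P2 P3 S L \<longleftrightarrow>
     latin_hypercube n S L \<and> (\<forall>B\<in>blocks P1 P2 P3. each_symbol_once S L B)"

definition orthogonal_hypercubes :: "nat \<Rightarrow> (cell \<Rightarrow> 's) \<Rightarrow> (cell \<Rightarrow> 's) \<Rightarrow> bool" where
  "orthogonal_hypercubes n L M \<longleftrightarrow> inj_on (\<lambda>x. (L x, M x)) (cube n)"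

definition mutually_orthogonal :: "nat \<Rightarrow> (cell \<Rightarrow> 's) set \<Rightarrow> bool" where
  "mutually_orthogonal n F \<longleftrightarrow> pairwise (orthogonal_hypercubes n) F"

end

theory Submission
  imports Defs
begin

text \<open>Fix a block \<open>G1 \<times> G2 \<times> G3\<close> and a cell \<open>z = (z1, z2, z3)\<close> outside it that leaves the block only
  in the first direction: \<open>z1 \<notin> G1\<close>, \<open>z2 \<in> G2\<close>, \<open>z3 \<in> G3\<close>. Such a \<open>z1\<close> exists because
  \<open>b1 < n\<close>. In each Sudoku hypercube \<open>L\<close> of the family the symbol \<open>L z\<close> occurs again in the block,
  at a cell \<open>x L\<close>. As a symbol is not repeated on a hyperplane, \<open>x L\<close> avoids the second and
  third coordinates of \<open>z\<close>, which leaves \<open>b1 (b2 - 1) (b3 - 1)\<close> positions. Two orthogonal members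
  cannot share a position \<open>x\<close>, since the pair of symbols at \<open>z\<close> would be repeated at \<open>x\<close>.
  So \<open>L \<mapsto> x L\<close> is an injection into the available positions.\<close>

lemma each_symbol_onceD:
  assumes "each_symbol_once S L B" "L x \<in> S" "x \<in> B" "y \<in> B" "L x = L y"
  shows "x = y"
  using assms unfolding each_symbol_once_def by metis

lemma latin_hypercube_repeat_differs:
  assumes lat: "latin_hypercube n S L"
    and x: "(x1, x2, x3) \<in> cube n" and y: "(y1, y2, y3) \<in> cube n"
    and ne: "(x1, x2, x3) \<noteq> (y1, y2, y3)"
    and eq: "L (x1, x2, x3) = L (y1, y2, y3)"
  shows "x1 \<noteq> y1" and "x2 \<noteq> y2" and "x3 \<noteq> y3"
proof -
  have sym: "L (x1, x2, x3) \<in> S"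
    using lat x unfolding latin_hypercube_def by (auto dest: PiE_mem)
  have apart: "\<not> ((x1, x2, x3) \<in> H \<and> (y1, y2, y3) \<in> H)" if "H \<in> hyperplanes n" for H
    using that lat each_symbol_onceD[OF _ sym _ _ eq] ne
    unfolding latin_hypercube_def by blast
  have "{x1} \<times> {1..n} \<times> {1..n} \<in> hyperplanes n"
    "{1..n} \<times> {x2} \<times> {1..n} \<in> hyperplanes n"
    "{1..n} \<times> {1..n} \<times> {x3} \<in> hyperplanes n"
    using x unfolding hyperplanes_def cube_def by blast+
  from this[THEN apart] show "x1 \<noteq> y1" and "x2 \<noteq> y2" and "x3 \<noteq> y3"
    using x y unfolding cube_def by auto
qed

text \<open>The block supplies an occurrence of the symbol at \<open>z\<close>, and \<open>z1 \<notin> G1\<close> makes it a second one.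
  The Latin condition then keeps it off the hyperplanes through \<open>z\<close>; the one in the first
  direction misses the block, so only the other two remove cells.\<close>

lemma sudoku_hypercube_repeat_in_block:
  assumes sud: "sudoku_hypercube n P1 P2 P3 S L"
    and G: "G1 \<in> P1" "G2 \<in> P2" "G3 \<in> P3"
    and sub: "G1 \<times> G2 \<times> G3 \<subseteq> cube n"
    and z: "(z1, z2, z3) \<in> cube n" "z1 \<notin> G1"
  obtains x where "x \<in> G1 \<times> (G2 - {z2}) \<times> (G3 - {z3})" and "L x = L (z1, z2, z3)"
proof -
  have lat: "latin_hypercube n S L" and "G1 \<times> G2 \<times> G3 \<in> blocks P1 P2 P3"
    using sud G unfolding sudoku_hypercube_def blocks_def by blast+
  then have "each_symbol_once S L (G1 \<times> G2 \<times> G3)"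
    using sud unfolding sudoku_hypercube_def by blast
  moreover have "L (z1, z2, z3) \<in> S"
    using lat z unfolding latin_hypercube_def by (auto dest: PiE_mem)
  ultimately obtain x1 x2 x3
    where x: "(x1, x2, x3) \<in> G1 \<times> G2 \<times> G3" and eq: "L (x1, x2, x3) = L (z1, z2, z3)"
    unfolding each_symbol_once_def by (metis prod_cases3)
  have "(x1, x2, x3) \<noteq> (z1, z2, z3)"
    using x z(2) by auto
  from latin_hypercube_repeat_differs[OF lat _ z(1) this eq] x sub
  have "(x1, x2, x3) \<in> G1 \<times> (G2 - {z2}) \<times> (G3 - {z3})"
    by blast
  then show thesis
    using eq that by blast
qed

text \<open>A cell of \<open>X\<close> serves at most one member of the family: two members repeating their symbols at
  the same cell would repeat the ordered pair at \<open>z\<close>.\<close>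

lemma card_le_of_repeats:
  assumes orth: "mutually_orthogonal n F"
    and X: "finite X" "X \<subseteq> cube n" and z: "z \<in> cube n" "z \<notin> X"
    and rep: "\<And>L. L \<in> F \<Longrightarrow> \<exists>x\<in>X. L x = L z"
  shows "finite F \<and> card F \<le> card X"
proof -
  obtain f where f: "\<And>L. L \<in> F \<Longrightarrow> f L \<in> X \<and> L (f L) = L z"
    using rep by metis
  have inj: "inj_on f F"
  proof (rule inj_onI, rule ccontr)
    fix L M assume LM: "L \<in> F" "M \<in> F" "f L = f M" "L \<noteq> M"
    then have "inj_on (\<lambda>x. (L x, M x)) (cube n)"
      using orth unfolding mutually_orthogonal_def pairwise_def orthogonal_hypercubes_def by blast
    moreover have "(L (f L), M (f L)) = (L z, M z)" "f L \<in> cube n"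
      using f[OF LM(1)] f[OF LM(2)] LM(3) X(2) by auto
    ultimately have "f L = z"
      using z(1) by (simp add: inj_on_def)
    then show False
      using f LM(1) z(2) by auto
  qed
  have img: "f ` F \<subseteq> X"
    using f by blast
  show ?thesis
    using inj img X(1) by (meson card_inj_on_le inj_on_finite)
qed

lemma equal_partition_obtain_group:
  assumes "equal_partition n a b P" "a > 0"
  obtains G z where "G \<in> P" "G \<subseteq> {1..n}" "card G = b" "z \<in> G"
proof -
  have "P \<noteq> {}"
    using assms unfolding equal_partition_def by auto
  then obtain G where "G \<in> P"
    by blast
  moreover have "G \<noteq> {}" "G \<subseteq> {1..n}" "card G = b"
    using assms(1) \<open>G \<in> P\<close> unfolding equal_partition_def partition_on_def by auto
  ultimately show thesis
    using that by blast
qed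

theorem lemma4p1:
  fixes n a1 a2 a3 b1 b2 b3 :: nat
    and P1 P2 P3 :: "nat set set"
    and F :: "(cell \<Rightarrow> 's) set"
  assumes "a1 > 0" and "a2 > 0" and "a3 > 0"
    and "n = a1 * a2 * a3"
    and "b1 = n div a1" and "b2 = n div a2" and "b3 = n div a3"
    and "equal_partition n a1 b1 P1"
    and "equal_partition n a2 b2 P2"
    and "equal_partition n a3 b3 P3"
    and "\<forall>L\<in>F. \<exists>S. sudoku_hypercube n P1 P2 P3 S L"
    and "mutually_orthogonal n F"
    and "b1 < n"
  shows "finite F \<and> card F \<le> b1 * (b2 - 1) * (b3 - 1)"
proof -
  obtain G1 where G1: "G1 \<in> P1" "G1 \<subseteq> {1..n}" "card G1 = b1"
    using equal_partition_obtain_group assms(1,8) by metis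
  obtain G2 z2 where G2: "G2 \<in> P2" "G2 \<subseteq> {1..n}" "card G2 = b2" "z2 \<in> G2"
    using equal_partition_obtain_group assms(2,9) by metis
  obtain G3 z3 where G3: "G3 \<in> P3" "G3 \<subseteq> {1..n}" "card G3 = b3" "z3 \<in> G3"
    using equal_partition_obtain_group assms(3,10) by metis
  have "G1 \<noteq> {1..n}"
    using G1(3) \<open>b1 < n\<close> by auto
  then obtain z1 where z1: "z1 \<in> {1..n}" "z1 \<notin> G1"
    using G1(2) by blast
  define X where "X = G1 \<times> (G2 - {z2}) \<times> (G3 - {z3})"
  have fin: "finite G1" "finite G2" "finite G3"
    using G1(2) G2(2) G3(2) finite_subset by blast+
  have block: "G1 \<times> G2 \<times> G3 \<subseteq> cube n" and z: "(z1, z2, z3) \<in> cube n"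
    using G1(2) G2(2,4) G3(2,4) z1(1) unfolding cube_def by blast+
  have "finite F \<and> card F \<le> card X"
  proof (rule card_le_of_repeats[OF assms(12) _ _ z])
    show "finite X"
      using fin unfolding X_def by blast
    show "X \<subseteq> cube n"
      using block unfolding X_def by blast
    show "(z1, z2, z3) \<notin> X"
      using z1(2) unfolding X_def by blast
    show "\<exists>x\<in>X. L x = L (z1, z2, z3)" if "L \<in> F" for L
      using that assms(11) sudoku_hypercube_repeat_in_block[OF _ G1(1) G2(1) G3(1) block z z1(2)]
      unfolding X_def by metis
  qed
  moreover have "card X = b1 * (b2 - 1) * (b3 - 1)"
    using fin G1(3) G2(3,4) G3(3,4) unfolding X_def by (simp add: card_cartesian_product)
  ultimately show ?thesis
    by simp
qed

end
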